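(* Let $f\colon X\to X$ be a piecewise $\lambda$-contraction and $x_0\in X$. If $\Omega(f)\cap S(f)=\emptyset$, then there exists $n\in\mathbb{N}$ such that every regular point of order $n$ of $f$ is a regular point and $\mathscr{C}^{(n)}$ is strongly invariant.
   Context: $(X,d)$ is a compact metric space whose open balls are connected, with $\mathrm{diam}(X)>0$, and $\lambda\in(0,1)$. A piecewise $\lambda$-contraction $f$: there exist $N\in\mathbb{N}$, open connected pairwise disjoint $A_1,\dots,A_N\subset X$ with dense union $X'$, and bi-Lipschitz $\varphi_i\colon X\to X$ with Lipschitz constant $\le\lambda$, $f|_{A_i}=\varphi_i|_{A_i}$; $S(f)=X\setminus X'$. $x$ is regular of order $n$ if $f^j(x)\notin S(f)$ for $0\le j<n$, regular if for all $n$. $\mathcal{I}_n(f)$ is the set of tuples $(i_0,\dots,i_{n-1})$ such that some regular point $x$ of order $n$ has $f^j(x)\in A_{i_j}$ for $0\le j<n$. For $\alpha=(i_0,\dots,i_{n-1})$, $\varphi^\alpha=\varphi_{i_{n-1}}\circ\cdots\circ\varphi_{i_0}$ and $\Omega(f)=\bigcap_{m\ge1}\overline{\bigcup_{n\ge m}\{\varphi^\alpha(x_0):\alpha\in\mathcal{I}_n(f)\}}$. $\mathscr{C}^{(1)}=\{A_i\}$, and for $n\ge2$, $\mathscr{C}^{(n)}$ is the collection of the nonempty open sets $A^\alpha=A_{i_0}\cap\varphi_{i_0}^{-1}(A_{i_1})\cap\cdots\cap(\varphi_{i_{n-2}}\circ\cdots\circ\varphi_{i_0})^{-1}(A_{i_{n-1}})$,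 $\alpha\in\mathcal{I}_n(f)$. A collection $\mathscr{C}$ of finitely many pairwise disjoint subsets of $X$ is strongly invariant if there is $n_0\ge1$ such that: (i) for each $A\in\mathscr{C}$ there is $A'\in\mathscr{C}$ with $f(A)\subset A'$; (ii) for each $B\in\mathscr{C}$ and $n\ge n_0$ there is $B'\in\mathscr{C}$ with $\overline{f^n(B)}\subset B'$; (iii) each $C\in\mathscr{C}$ is contained in some $A_i$. *)

theory Defs
  imports "HOL-Analysis.Analysis"
begin

definition standing_space :: "'a::metric_space set \<Rightarrow> bool" where
  "standing_space X \<longleftrightarrow> compact X \<and> (\<forall>x\<in>X. \<forall>r>0. connected (ball x r \<inter> X))
     \<and> diameter X > 0"

definition piecewise_contraction ::
  "'a::metric_space set \<Rightarrow> real \<Rightarrow> ('a \<Rightarrow> 'a) \<Rightarrow> nat \<Rightarrow> (nat \<Rightarrow> 'a set) \<Rightarrow> (nat \<Rightarrow> 'a \<Rightarrow> 'a) \<Rightarrow> bool"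
  where
  "piecewise_contraction X lam f N A \<phi> \<longleftrightarrow>
     f ` X \<subseteq> X
   \<and> (\<forall>i<N. openin (top_of_set X) (A i) \<and> connected (A i))
   \<and> (\<forall>i<N. \<forall>j<N. i \<noteq> j \<longrightarrow> A i \<inter> A j = {})
   \<and> X \<subseteq> closure (\<Union>i<N. A i)
   \<and> (\<forall>i<N. \<phi> i ` X \<subseteq> X \<and> lam-lipschitz_on X (\<phi> i)
          \<and> (\<exists>c>0. \<forall>x\<in>X. \<forall>y\<in>X. c * dist x y \<le> dist (\<phi> i x) (\<phi> i y)))
   \<and> (\<forall>i<N. \<forall>x\<in>A i. f x = \<phi> i x)"

definition singular_set :: "'a set \<Rightarrow> nat \<Rightarrow> (nat \<Rightarrow> 'a set) \<Rightarrow> 'a set" where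
  "singular_set X N A = X - (\<Union>i<N. A i)"

definition regular_of_order ::
  "'a set \<Rightarrow> ('a \<Rightarrow> 'a) \<Rightarrow> nat \<Rightarrow> (nat \<Rightarrow> 'a set) \<Rightarrow> nat \<Rightarrow> 'a \<Rightarrow> bool" where
  "regular_of_order X f N A n x \<longleftrightarrow> x \<in> X \<and> (\<forall>j<n. (f ^^ j) x \<notin> singular_set X N A)"

definition regular_point ::
  "'a set \<Rightarrow> ('a \<Rightarrow> 'a) \<Rightarrow> nat \<Rightarrow> (nat \<Rightarrow> 'a set) \<Rightarrow> 'a \<Rightarrow> bool" where
  "regular_point X f N A x \<longleftrightarrow> (\<forall>n. regular_of_order X f N A n x)"

definition itineraries ::
  "'a set \<Rightarrow> ('a \<Rightarrow> 'a) \<Rightarrow> nat \<Rightarrow> (nat \<Rightarrow> 'a set) \<Rightarrow> nat \<Rightarrow> nat list set" where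
  "itineraries X f N A n = {\<alpha>. length \<alpha> = n \<and> set \<alpha> \<subseteq> {..<N} \<and>
      (\<exists>x. regular_of_order X f N A n x \<and> (\<forall>j<n. (f ^^ j) x \<in> A (\<alpha> ! j)))}"

text \<open>phi_comp phi [i0,...,i(n-1)] = phi i(n-1) o ... o phi i0.\<close>
fun phi_comp :: "(nat \<Rightarrow> 'a \<Rightarrow> 'a) \<Rightarrow> nat list \<Rightarrow> 'a \<Rightarrow> 'a" where
  "phi_comp \<phi> [] = id"
| "phi_comp \<phi> (i # \<alpha>) = phi_comp \<phi> \<alpha> \<circ> \<phi> i"

definition Omega ::
  "'a::topological_space set \<Rightarrow> ('a \<Rightarrow> 'a) \<Rightarrow> nat \<Rightarrow> (nat \<Rightarrow> 'a set) \<Rightarrow> (nat \<Rightarrow> 'a \<Rightarrow> 'a) \<Rightarrow> 'a \<Rightarrow> 'a set" where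
  "Omega X f N A \<phi> x0 = (\<Inter>m\<in>{1..}. closure (\<Union>n\<in>{m..}. (\<lambda>\<alpha>. phi_comp \<phi> \<alpha> x0) ` itineraries X f N A n))"

text \<open>A^alpha = A_i0 \<inter> phi_i0^-1(A_i1) \<inter> ... \<inter> (phi_i(n-2) o ... o phi_i0)^-1 (A_i(n-1)).\<close>
definition cylinder :: "'a set \<Rightarrow> (nat \<Rightarrow> 'a set) \<Rightarrow> (nat \<Rightarrow> 'a \<Rightarrow> 'a) \<Rightarrow> nat list \<Rightarrow> 'a set" where
  "cylinder X A \<phi> \<alpha> = {x\<in>X. \<forall>j<length \<alpha>. phi_comp \<phi> (take j \<alpha>) x \<in> A (\<alpha> ! j)}"

definition cyl_collection ::
  "'a set \<Rightarrow> ('a \<Rightarrow> 'a) \<Rightarrow> nat \<Rightarrow> (nat \<Rightarrow> 'a set) \<Rightarrow> (nat \<Rightarrow> 'a \<Rightarrow> 'a) \<Rightarrow> nat \<Rightarrow> 'a set set" where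
  "cyl_collection X f N A \<phi> n =
     (if n = 1 then A ` {..<N}
      else {cylinder X A \<phi> \<alpha> | \<alpha>. \<alpha> \<in> itineraries X f N A n \<and> cylinder X A \<phi> \<alpha> \<noteq> {}})"

definition strongly_invariant ::
  "'a::topological_space set \<Rightarrow> ('a \<Rightarrow> 'a) \<Rightarrow> nat \<Rightarrow> (nat \<Rightarrow> 'a set) \<Rightarrow> 'a set set \<Rightarrow> bool" where
  "strongly_invariant X f N A \<C> \<longleftrightarrow>
     finite \<C> \<and> pairwise disjnt \<C> \<and> (\<forall>C\<in>\<C>. C \<subseteq> X) \<and>
     (\<exists>n0\<ge>1.
        (\<forall>C\<in>\<C>. \<exists>C'\<in>\<C>. f ` C \<subseteq> C') \<and>
        (\<forall>B\<in>\<C>. \<forall>n\<ge>n0. \<exists>B'\<in>\<C>. closure ((f ^^ n) ` B) \<subseteq> B') \<and>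
        (\<forall>C\<in>\<C>. \<exists>i<N. C \<subseteq> A i))"

end

theory Submission
  imports Defs
begin

(* Let \<delta> > 0 separate the compact set \<Omega>(f) from the closed singular set S(f). For long
   itineraries \<alpha>, the orbit point \<phi>^\<alpha>(x0) lies within \<delta>/2 of \<Omega>(f) and \<phi>^\<alpha>(X) has
   diameter at most \<lambda>^|\<alpha>| diam X < \<delta>/2, so the connected set \<phi>^\<alpha>(X) misses S(f) and lies
   in a single piece. Hence beyond some length n0 the next symbol of an orbit is determined by
   its itinerary so far: regularity of an order n \<ge> n0 propagates to all orders, and points of
   one n-cylinder share their whole itinerary, so f^m maps n-cylinders into n-cylinders. For
   m \<ge> n0 the image f^m(A^\<alpha>) lies in the compact set \<phi>^\<gamma>(X), \<gamma> being the common itinerary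
   of length m, and \<phi>^\<gamma>(X) already lies in the target cylinder; this gives the closure
   condition of strong invariance. *)

lemma separate_compact_closed_metric:
  fixes S T :: "'a::metric_space set"
  assumes "compact S" and T: "closed T" "S \<inter> T = {}"
  shows "\<exists>\<delta>>0. \<forall>x\<in>S. \<forall>y\<in>T. \<delta> \<le> dist x y"
proof cases
  assume "S \<noteq> {} \<and> T \<noteq> {}"
  then have "S \<noteq> {}" "T \<noteq> {}" by auto
  let ?inf = "\<lambda>x. infdist x T"
  have "continuous_on S ?inf"
    by (auto intro!: continuous_at_imp_continuous_on continuous_infdist continuous_ident)
  then obtain x where x: "x \<in> S" "\<forall>y\<in>S. ?inf x \<le> ?inf y"
    using continuous_attains_inf[OF \<open>compact S\<close> \<open>S \<noteq> {}\<close>] by auto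
  then have "0 < ?inf x"
    using T \<open>T \<noteq> {}\<close> in_closed_iff_infdist_zero by (auto simp: less_le infdist_nonneg)
  moreover have "\<forall>x'\<in>S. \<forall>y\<in>T. ?inf x \<le> dist x' y"
    using x by (auto intro: order_trans infdist_le)
  ultimately show ?thesis by auto
qed (auto intro!: exI[of _ 1])

lemma decseq_closed_eventually_subset_open:
  fixes K :: "nat \<Rightarrow> 'a::topological_space set"
  assumes dec: "decseq K" and "compact (K 0)" and closed: "\<And>m. closed (K m)"
    and V: "open V" "(\<Inter>m\<in>{k..}. K m) \<subseteq> V"
  shows "\<exists>M\<ge>k. K M \<subseteq> V"
proof (rule ccontr)
  assume none: "\<not> ?thesis"
  have "(K 0 - V) \<inter> (\<Inter>m\<in>{k..}. K m) \<noteq> {}"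
  proof (rule compact_imp_fip_image)
    show "compact (K 0 - V)"
      using \<open>compact (K 0)\<close> V(1) by (rule compact_diff)
    show "closed (K m)" for m
      by (fact closed)
  next
    fix I assume I: "finite I" "I \<subseteq> {k..}"
    define M where "M = Max (insert k I)"
    have "M \<ge> k" and below_M: "\<And>i. i \<in> I \<Longrightarrow> i \<le> M"
      using I(1) by (auto simp: M_def)
    obtain y where y: "y \<in> K M" "y \<notin> V"
      using none \<open>M \<ge> k\<close> by blast
    have "y \<in> K i" if "i \<in> I" for i
      using decseqD[OF dec below_M[OF that]] y(1) by blast
    moreover have "y \<in> K 0"
      using decseqD[OF dec, of 0 M] y(1) by blast
    ultimately show "(K 0 - V) \<inter> (\<Inter>i\<in>I. K i) \<noteq> {}"
      using y(2) by blast
  qed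
  with V(2) show False by blast
qed

lemma connected_subset_Union_disjoint_openin:
  assumes pieces: "\<And>i. i \<in> I \<Longrightarrow> openin (top_of_set X) (A i)"
    and disj: "disjoint_family_on A I"
    and T: "connected T" "T \<noteq> {}" "T \<subseteq> (\<Union>i\<in>I. A i)"
  obtains j where "j \<in> I" "T \<subseteq> A j"
proof -
  have "\<forall>i\<in>I. \<exists>U. open U \<and> A i = X \<inter> U"
    using pieces openin_open by blast
  then obtain U where U: "\<And>i. i \<in> I \<Longrightarrow> open (U i)" "\<And>i. i \<in> I \<Longrightarrow> A i = X \<inter> U i"
    by metis
  obtain y j where j: "j \<in> I" "y \<in> T" "y \<in> A j"
    using T(2,3) by blast
  define U' where "U' = (\<Union>i\<in>I - {j}. U i)"
  have cover: "T \<subseteq> U j \<union> U'"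
  proof
    fix z assume "z \<in> T"
    then obtain i where "i \<in> I" "z \<in> A i"
      using T(3) by blast
    then show "z \<in> U j \<union> U'"
      using U(2) unfolding U'_def by (cases "i = j") auto
  qed
  have "U j \<inter> U' \<inter> T = {}"
  proof (rule ccontr)
    assume "U j \<inter> U' \<inter> T \<noteq> {}"
    then obtain z i where z: "z \<in> U j" "z \<in> T" "i \<in> I" "i \<noteq> j" "z \<in> U i"
      unfolding U'_def by blast
    have "z \<in> X"
      using z(2) T(3) U(2) by blast
    then have "z \<in> A i \<inter> A j"
      using z U(2) j(1) by blast
    with disj j(1) z(3,4) show False
      unfolding disjoint_family_on_def by blast
  qed
  then have "U j \<inter> T = {} \<or> U' \<inter> T = {}"
    using connectedD[OF T(1) U(1)[OF j(1)] _ _ cover] U(1) unfolding U'_def by blast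
  moreover have "y \<in> U j"
    using U(2) j by blast
  ultimately have "T \<subseteq> U j"
    using cover j(2) by blast
  then have "T \<subseteq> A j"
    using T(3) U(2) j(1) by blast
  with j(1) show thesis by (rule that)
qed

lemma connected_if_connected_balls:
  fixes X :: "'a::metric_space set"
  assumes "bounded X" "x \<in> X" "\<And>r. r > 0 \<Longrightarrow> connected (ball x r \<inter> X)"
  shows "connected X"
proof -
  obtain r where "r > 0" "X \<subseteq> ball x r"
    using bounded_subset_ballD[OF \<open>bounded X\<close>] by blast
  then show ?thesis
    using assms(3) by (metis inf.absorb2)
qed

locale pw_contraction =
  fixes X :: "'a::metric_space set" and lam :: real and f :: "'a \<Rightarrow> 'a"
    and N :: nat and A :: "nat \<Rightarrow> 'a set" and \<phi> :: "nat \<Rightarrow> 'a \<Rightarrow> 'a"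
  assumes standing: "standing_space X" and lam_pos: "0 < lam" and lam_less_1: "lam < 1"
    and contraction: "piecewise_contraction X lam f N A \<phi>"
begin

lemma f_in_X: "x \<in> X \<Longrightarrow> f x \<in> X"
  using contraction unfolding piecewise_contraction_def by auto

lemma A_openin: "i < N \<Longrightarrow> openin (top_of_set X) (A i)"
  using contraction unfolding piecewise_contraction_def by auto

lemma A_disjoint: "disjoint_family_on A {..<N}"
  using contraction unfolding piecewise_contraction_def disjoint_family_on_def by auto

lemma phi_in_X: "i < N \<Longrightarrow> x \<in> X \<Longrightarrow> \<phi> i x \<in> X"
  using contraction unfolding piecewise_contraction_def by blast

lemma phi_dist_le:
  "i < N \<Longrightarrow> x \<in> X \<Longrightarrow> y \<in> X \<Longrightarrow> dist (\<phi> i x) (\<phi> i y) \<le> lam * dist x y"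
  using contraction unfolding piecewise_contraction_def lipschitz_on_def by blast

lemma f_eq_phi: "i < N \<Longrightarrow> x \<in> A i \<Longrightarrow> f x = \<phi> i x"
  using contraction unfolding piecewise_contraction_def by blast

lemma funpow_in_X: "x \<in> X \<Longrightarrow> (f ^^ k) x \<in> X"
  by (induction k) (auto simp: f_in_X)

lemma compact_X: "compact X"
  using standing unfolding standing_space_def by auto

lemma closed_X: "closed X"
  using compact_X compact_imp_closed by auto

lemma bounded_X: "bounded X"
  using compact_X compact_imp_bounded by auto

lemma X_nonempty: "X \<noteq> {}"
  using standing unfolding standing_space_def by auto

lemma connected_X: "connected X"
proof -
  obtain x where "x \<in> X"
    using X_nonempty by blast
  moreover have "\<And>r. r > 0 \<Longrightarrow> connected (ball x r \<inter> X)"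
    using standing \<open>x \<in> X\<close> unfolding standing_space_def by blast
  ultimately show ?thesis
    using bounded_X connected_if_connected_balls by blast
qed

lemma not_singular_iff: "x \<in> X \<Longrightarrow> x \<notin> singular_set X N A \<longleftrightarrow> (\<exists>i<N. x \<in> A i)"
  unfolding singular_set_def by auto

lemma closed_singular_set: "closed (singular_set X N A)"
proof -
  have "closedin (top_of_set X) (X - (\<Union>i<N. A i))"
    using A_openin by (intro closedin_diff) auto
  then show ?thesis
    unfolding singular_set_def using closedin_closed_trans closed_X by blast
qed

lemma itineraries_subset_lists:
  "\<gamma> \<in> itineraries X f N A m \<Longrightarrow> set \<gamma> \<subseteq> {..<N} \<and> length \<gamma> = m"
  unfolding itineraries_def by auto

lemma regular_of_order_mono:
  "regular_of_order X f N A n x \<Longrightarrow> k \<le> n \<Longrightarrow> regular_of_order X f N A k x"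
  unfolding regular_of_order_def by auto

lemma regular_point_funpow:
  "regular_point X f N A x \<Longrightarrow> regular_point X f N A ((f ^^ m) x)"
  unfolding regular_point_def regular_of_order_def
  by (auto simp: funpow_in_X simp flip: funpow_add comp_apply[of "f^^_" "f^^_"])

lemma phi_comp_append: "phi_comp \<phi> (\<alpha> @ \<beta>) = phi_comp \<phi> \<beta> \<circ> phi_comp \<phi> \<alpha>"
  by (induction \<alpha>) auto

lemma phi_comp_in_X: "set \<gamma> \<subseteq> {..<N} \<Longrightarrow> z \<in> X \<Longrightarrow> phi_comp \<phi> \<gamma> z \<in> X"
  by (induction \<gamma> arbitrary: z) (auto simp: phi_in_X)

lemma phi_comp_dist_le:
  assumes "set \<gamma> \<subseteq> {..<N}" "z \<in> X" "w \<in> X"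
  shows "dist (phi_comp \<phi> \<gamma> z) (phi_comp \<phi> \<gamma> w) \<le> lam ^ length \<gamma> * dist z w"
  using assms
proof (induction \<gamma> arbitrary: z w)
  case (Cons i \<gamma>)
  then have "dist (phi_comp \<phi> \<gamma> (\<phi> i z)) (phi_comp \<phi> \<gamma> (\<phi> i w))
      \<le> lam ^ length \<gamma> * dist (\<phi> i z) (\<phi> i w)"
    by (simp add: phi_in_X)
  also have "\<dots> \<le> lam ^ length \<gamma> * (lam * dist z w)"
    using Cons.prems phi_dist_le lam_pos by (intro mult_left_mono) auto
  finally show ?case by (simp add: algebra_simps)
qed simp

lemma phi_comp_dist_le_diameter:
  "set \<gamma> \<subseteq> {..<N} \<Longrightarrow> z \<in> X \<Longrightarrow> w \<in> X \<Longrightarrow>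
    dist (phi_comp \<phi> \<gamma> z) (phi_comp \<phi> \<gamma> w) \<le> lam ^ length \<gamma> * diameter X"
  using phi_comp_dist_le diameter_bounded_bound[OF bounded_X] lam_pos
  by (meson mult_left_mono order_trans zero_le_power less_imp_le)

lemma continuous_on_phi_comp: "set \<gamma> \<subseteq> {..<N} \<Longrightarrow> continuous_on X (phi_comp \<phi> \<gamma>)"
  by (rule lipschitz_on_continuous_on[where L = "lam ^ length \<gamma>"])
    (use phi_comp_dist_le lam_pos in \<open>auto simp: lipschitz_on_def\<close>)

lemma compact_phi_comp_image: "set \<gamma> \<subseteq> {..<N} \<Longrightarrow> compact (phi_comp \<phi> \<gamma> ` X)"
  using compact_continuous_image continuous_on_phi_comp compact_X by blast

subsection \<open>Itineraries and cylinders\<close>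

(* symbol x k is unspecified when f^k(x) is singular. *)

definition symbol :: "'a \<Rightarrow> nat \<Rightarrow> nat" where
  "symbol x k = (THE i. i < N \<and> (f ^^ k) x \<in> A i)"

definition itinerary :: "'a \<Rightarrow> nat \<Rightarrow> nat list" where
  "itinerary x n = map (symbol x) [0..<n]"

lemma symbol_eqI: "j < N \<Longrightarrow> (f ^^ k) x \<in> A j \<Longrightarrow> symbol x k = j"
  unfolding symbol_def
  by (rule the_equality) (use A_disjoint in \<open>auto simp: disjoint_family_on_def\<close>)

lemma symbol_funpow: "symbol ((f ^^ m) x) k = symbol x (k + m)"
  unfolding symbol_def by (simp add: funpow_add)

lemma regular_of_order_symbol:
  assumes "regular_of_order X f N A n x" "k < n"
  shows "symbol x k < N \<and> (f ^^ k) x \<in> A (symbol x k)"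
proof -
  obtain j where "j < N" "(f ^^ k) x \<in> A j"
    using assms funpow_in_X not_singular_iff unfolding regular_of_order_def by blast
  then show ?thesis
    using symbol_eqI by simp
qed

lemma length_itinerary [simp]: "length (itinerary x n) = n"
  by (simp add: itinerary_def)

lemma nth_itinerary [simp]: "k < n \<Longrightarrow> itinerary x n ! k = symbol x k"
  by (simp add: itinerary_def)

lemma take_itinerary: "j \<le> n \<Longrightarrow> take j (itinerary x n) = itinerary x j"
  by (simp add: itinerary_def take_map)

lemma itinerary_add: "itinerary x (m + j) = itinerary x m @ itinerary ((f ^^ m) x) j"
  by (rule nth_equalityI) (auto simp: itinerary_def symbol_funpow nth_append add.commute)

lemma set_itinerary: "regular_of_order X f N A n x \<Longrightarrow> set (itinerary x n) \<subseteq> {..<N}"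
  using regular_of_order_symbol by (auto simp: itinerary_def)

lemma itinerary_in_itineraries:
  "regular_of_order X f N A n x \<Longrightarrow> itinerary x n \<in> itineraries X f N A n"
  unfolding itineraries_def using set_itinerary regular_of_order_symbol
  by (auto simp: itinerary_def)

lemma funpow_eq_phi_comp_itinerary:
  "regular_of_order X f N A n x \<Longrightarrow> (f ^^ n) x = phi_comp \<phi> (itinerary x n) x"
proof (induction n)
  case (Suc n)
  then have "(f ^^ n) x = phi_comp \<phi> (itinerary x n) x"
    using regular_of_order_mono by force
  moreover have "f ((f ^^ n) x) = \<phi> (symbol x n) ((f ^^ n) x)"
    using regular_of_order_symbol[OF Suc.prems] f_eq_phi by blast
  ultimately show ?case
    by (simp add: itinerary_def phi_comp_append)
qed (simp add: itinerary_def)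

lemma funpow_eq_phi_comp_take:
  assumes "set \<alpha> \<subseteq> {..<N}" "x \<in> cylinder X A \<phi> \<alpha>" "j \<le> length \<alpha>"
  shows "(f ^^ j) x = phi_comp \<phi> (take j \<alpha>) x"
  using assms(3)
proof (induction j)
  case (Suc j)
  then have j: "j < length \<alpha>"
    by simp
  have "\<alpha> ! j < N"
    using assms(1) nth_mem[OF j] by blast
  moreover have "phi_comp \<phi> (take j \<alpha>) x \<in> A (\<alpha> ! j)"
    using assms(2) j unfolding cylinder_def by blast
  ultimately have "f (phi_comp \<phi> (take j \<alpha>) x) = \<phi> (\<alpha> ! j) (phi_comp \<phi> (take j \<alpha>) x)"
    by (rule f_eq_phi)
  then show ?case
    using Suc j by (simp add: take_Suc_conv_app_nth phi_comp_append)
qed simp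

lemma mem_cylinder_iff:
  assumes "set \<alpha> \<subseteq> {..<N}"
  shows "x \<in> cylinder X A \<phi> \<alpha> \<longleftrightarrow>
    regular_of_order X f N A (length \<alpha>) x \<and> itinerary x (length \<alpha>) = \<alpha>"
proof
  assume x: "x \<in> cylinder X A \<phi> \<alpha>"
  have below_N: "\<And>j. j < length \<alpha> \<Longrightarrow> \<alpha> ! j < N"
    using assms nth_mem by fastforce
  have "(f ^^ j) x \<in> A (\<alpha> ! j)" if "j < length \<alpha>" for j
    using funpow_eq_phi_comp_take[OF assms x] x that unfolding cylinder_def by simp
  moreover have "x \<in> X"
    using x unfolding cylinder_def by blast
  ultimately show "regular_of_order X f N A (length \<alpha>) x \<and> itinerary x (length \<alpha>) = \<alpha>"
    using below_N not_singular_iff funpow_in_X symbol_eqI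
    by (auto simp: regular_of_order_def itinerary_def intro!: nth_equalityI)
next
  assume x: "regular_of_order X f N A (length \<alpha>) x \<and> itinerary x (length \<alpha>) = \<alpha>"
  have "phi_comp \<phi> (take j \<alpha>) x \<in> A (\<alpha> ! j)" if "j < length \<alpha>" for j
  proof -
    have "take j \<alpha> = itinerary x j"
      using x that take_itinerary[of j "length \<alpha>" x] by simp
    moreover have "regular_of_order X f N A j x"
      using x that regular_of_order_mono less_imp_le by blast
    ultimately have "phi_comp \<phi> (take j \<alpha>) x = (f ^^ j) x"
      by (metis funpow_eq_phi_comp_itinerary)
    moreover have "\<alpha> ! j = symbol x j"
      using x that nth_itinerary by metis
    ultimately show ?thesis
      using regular_of_order_symbol x that by metis
  qed
  then show "x \<in> cylinder X A \<phi> \<alpha>"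
    using x unfolding cylinder_def regular_of_order_def by blast
qed

lemma mem_cylinder_itinerary_iff:
  "regular_of_order X f N A n x \<Longrightarrow>
    y \<in> cylinder X A \<phi> (itinerary x n) \<longleftrightarrow>
    regular_of_order X f N A n y \<and> itinerary y n = itinerary x n"
  using mem_cylinder_iff[OF set_itinerary] by simp

lemma cyl_collection_eq:
  assumes "n \<noteq> 1"
  shows "cyl_collection X f N A \<phi> n =
    (\<lambda>x. cylinder X A \<phi> (itinerary x n)) ` {x. regular_of_order X f N A n x}"
proof (intro equalityI subsetI)
  fix C assume "C \<in> cyl_collection X f N A \<phi> n"
  then obtain \<alpha> where \<alpha>: "\<alpha> \<in> itineraries X f N A n" "C = cylinder X A \<phi> \<alpha>" "C \<noteq> {}"
    using assms unfolding cyl_collection_def by auto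
  then obtain x where "x \<in> cylinder X A \<phi> \<alpha>"
    by blast
  then have "regular_of_order X f N A n x" "itinerary x n = \<alpha>"
    using mem_cylinder_iff itineraries_subset_lists[OF \<alpha>(1)] by auto
  with \<alpha>(2) show "C \<in> (\<lambda>x. cylinder X A \<phi> (itinerary x n)) ` {x. regular_of_order X f N A n x}"
    by blast
next
  fix C assume "C \<in> (\<lambda>x. cylinder X A \<phi> (itinerary x n)) ` {x. regular_of_order X f N A n x}"
  then obtain x where x: "regular_of_order X f N A n x" "C = cylinder X A \<phi> (itinerary x n)"
    by blast
  then have "x \<in> C"
    using mem_cylinder_itinerary_iff by blast
  then show "C \<in> cyl_collection X f N A \<phi> n"
    using assms x itinerary_in_itineraries unfolding cyl_collection_def by auto
qed

lemma finite_cyl_collection: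
  assumes "n \<noteq> 1"
  shows "finite (cyl_collection X f N A \<phi> n)"
proof -
  have "(\<lambda>x. itinerary x n) ` {x. regular_of_order X f N A n x}
      \<subseteq> {\<alpha>. set \<alpha> \<subseteq> {..<N} \<and> length \<alpha> = n}"
    using set_itinerary by auto
  then have "finite ((\<lambda>x. itinerary x n) ` {x. regular_of_order X f N A n x})"
    using finite_subset[OF _ finite_lists_length_eq] by blast
  then have "finite (cylinder X A \<phi> ` (\<lambda>x. itinerary x n) ` {x. regular_of_order X f N A n x})"
    by (rule finite_imageI)
  then show ?thesis
    unfolding cyl_collection_eq[OF assms] image_image .
qed

lemma pairwise_disjnt_cyl_collection:
  assumes "n \<noteq> 1"
  shows "pairwise disjnt (cyl_collection X f N A \<phi> n)"
proof -
  have "disjnt (cylinder X A \<phi> (itinerary x n)) (cylinder X A \<phi> (itinerary y n))"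
    if "regular_of_order X f N A n x" "regular_of_order X f N A n y"
      "cylinder X A \<phi> (itinerary x n) \<noteq> cylinder X A \<phi> (itinerary y n)" for x y
    using that mem_cylinder_itinerary_iff unfolding disjnt_def by (metis disjoint_iff)
  then show ?thesis
    unfolding cyl_collection_eq[OF assms] pairwise_def by blast
qed

lemma cylinder_itinerary_subset_piece:
  assumes "0 < n"
  shows "cylinder X A \<phi> (itinerary x n) \<subseteq> A (symbol x 0)"
  using assms unfolding cylinder_def by auto

subsection \<open>Long compositions map X into a single piece\<close>

lemma compact_Omega:
  assumes "x0 \<in> X"
  shows "compact (Omega X f N A \<phi> x0)"
proof -
  have "closure (\<Union>n\<in>{1..}. (\<lambda>\<alpha>. phi_comp \<phi> \<alpha> x0) ` itineraries X f N A n) \<subseteq> X"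
    using assms closed_X phi_comp_in_X itineraries_subset_lists by (intro closure_minimal) auto
  then have "Omega X f N A \<phi> x0 \<subseteq> X"
    unfolding Omega_def by fastforce
  moreover have "closed (Omega X f N A \<phi> x0)"
    unfolding Omega_def by auto
  then have "compact (Omega X f N A \<phi> x0 \<inter> X)"
    using compact_X by (rule closed_Int_compact)
  ultimately show ?thesis
    by (simp add: Int_absorb2)
qed

lemma orbit_eventually_in_open:
  assumes x0: "x0 \<in> X" and V: "open V" "Omega X f N A \<phi> x0 \<subseteq> V"
  shows "\<exists>M. \<forall>m\<ge>M. \<forall>\<gamma>\<in>itineraries X f N A m. phi_comp \<phi> \<gamma> x0 \<in> V"
proof -
  define K where "K m = closure (\<Union>n\<in>{m..}. (\<lambda>\<alpha>. phi_comp \<phi> \<alpha> x0) ` itineraries X f N A n)"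
    for m
  have "decseq K"
    unfolding K_def decseq_def by (intro allI impI closure_mono) force
  have "K 0 \<subseteq> X"
    unfolding K_def using x0 closed_X phi_comp_in_X itineraries_subset_lists
    by (intro closure_minimal) auto
  moreover have "compact (K 0 \<inter> X)"
    unfolding K_def using compact_X by (intro closed_Int_compact) auto
  ultimately have "compact (K 0)"
    by (simp add: Int_absorb2)
  moreover have "(\<Inter>m\<in>{1..}. K m) \<subseteq> V"
    using V(2) unfolding Omega_def K_def .
  ultimately obtain M where "K M \<subseteq> V"
    using decseq_closed_eventually_subset_open[OF \<open>decseq K\<close> _ _ V(1)] unfolding K_def by blast
  moreover have "phi_comp \<phi> \<gamma> x0 \<in> K M" if "m \<ge> M" "\<gamma> \<in> itineraries X f N A m" for m \<gamma>
    unfolding K_def using that closure_subset by fastforce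
  ultimately show ?thesis
    by blast
qed

lemma phi_comp_image_in_piece:
  assumes \<gamma>: "set \<gamma> \<subseteq> {..<N}" and regular: "phi_comp \<phi> \<gamma> ` X \<inter> singular_set X N A = {}"
  shows "\<exists>j<N. phi_comp \<phi> \<gamma> ` X \<subseteq> A j"
proof -
  have "phi_comp \<phi> \<gamma> ` X \<subseteq> (\<Union>i<N. A i)"
    using regular phi_comp_in_X[OF \<gamma>] unfolding singular_set_def by blast
  moreover have "connected (phi_comp \<phi> \<gamma> ` X)"
    using connected_continuous_image[OF continuous_on_phi_comp[OF \<gamma>] connected_X] .
  moreover have "phi_comp \<phi> \<gamma> ` X \<noteq> {}"
    using X_nonempty by blast
  ultimately obtain j where "j \<in> {..<N}" "phi_comp \<phi> \<gamma> ` X \<subseteq> A j"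
    using connected_subset_Union_disjoint_openin[OF A_openin A_disjoint] by blast
  then show ?thesis
    by blast
qed

lemma eventually_images_in_pieces:
  assumes x0: "x0 \<in> X" and Omega_regular: "Omega X f N A \<phi> x0 \<inter> singular_set X N A = {}"
  shows "\<exists>n0. \<forall>m\<ge>n0. \<forall>\<gamma>\<in>itineraries X f N A m. \<exists>j<N. phi_comp \<phi> \<gamma> ` X \<subseteq> A j"
proof -
  let ?\<Omega> = "Omega X f N A \<phi> x0"
  obtain \<delta> where "\<delta> > 0" and \<delta>: "\<And>w y. w \<in> ?\<Omega> \<Longrightarrow> y \<in> singular_set X N A \<Longrightarrow> \<delta> \<le> dist w y"
    using separate_compact_closed_metric[OF compact_Omega[OF x0] closed_singular_set Omega_regular]
    by blast
  obtain M where M: "\<And>m \<gamma>. m \<ge> M \<Longrightarrow> \<gamma> \<in> itineraries X f N A m \<Longrightarrow>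
      phi_comp \<phi> \<gamma> x0 \<in> (\<Union>w\<in>?\<Omega>. ball w (\<delta>/2))"
    using orbit_eventually_in_open[OF x0, of "\<Union>w\<in>?\<Omega>. ball w (\<delta>/2)"] \<open>\<delta> > 0\<close> by force
  have "(\<lambda>m. lam ^ m * diameter X) \<longlonglongrightarrow> 0"
    using lam_pos lam_less_1 by (intro tendsto_mult_left_zero LIMSEQ_power_zero) simp
  then obtain k where k: "\<And>m. m \<ge> k \<Longrightarrow> lam ^ m * diameter X < \<delta>/2"
    using order_tendstoD(2)[of _ 0 sequentially "\<delta>/2"] \<open>\<delta> > 0\<close>
    unfolding eventually_sequentially by auto
  have "phi_comp \<phi> \<gamma> ` X \<inter> singular_set X N A = {}"
    if m: "m \<ge> max M k" and \<gamma>: "\<gamma> \<in> itineraries X f N A m" for m \<gamma>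
  proof -
    have \<gamma>_lists: "set \<gamma> \<subseteq> {..<N}" "length \<gamma> = m"
      using itineraries_subset_lists[OF \<gamma>] by auto
    obtain w where w: "w \<in> ?\<Omega>" "dist w (phi_comp \<phi> \<gamma> x0) < \<delta>/2"
      using M[OF _ \<gamma>] m by auto
    have "dist w (phi_comp \<phi> \<gamma> z) < \<delta>" if "z \<in> X" for z
    proof -
      have "dist (phi_comp \<phi> \<gamma> x0) (phi_comp \<phi> \<gamma> z) < \<delta>/2"
        using phi_comp_dist_le_diameter[OF \<gamma>_lists(1) x0 that] k[of m] m \<gamma>_lists(2) by simp
      with w(2) show ?thesis
        using dist_triangle[of w "phi_comp \<phi> \<gamma> z" "phi_comp \<phi> \<gamma> x0"] by simp
    qed
    then show ?thesis
      using \<delta>[OF w(1)] by force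
  qed
  then show ?thesis
    using phi_comp_image_in_piece itineraries_subset_lists by (metis max.bounded_iff)
qed

end

subsection \<open>Strong invariance of the cylinder partition\<close>

locale eventually_in_pieces = pw_contraction +
  fixes n0 :: nat
  assumes image_in_piece:
    "n0 \<le> m \<Longrightarrow> \<gamma> \<in> itineraries X f N A m \<Longrightarrow> \<exists>j<N. phi_comp \<phi> \<gamma> ` X \<subseteq> A j"
begin

lemma image_itinerary_subset_piece:
  assumes "n0 \<le> m" and x: "regular_of_order X f N A m x"
  shows "symbol x m < N \<and> phi_comp \<phi> (itinerary x m) ` X \<subseteq> A (symbol x m)"
proof -
  obtain j where j: "j < N" "phi_comp \<phi> (itinerary x m) ` X \<subseteq> A j"
    using image_in_piece[OF assms(1) itinerary_in_itineraries[OF x]] by blast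
  have "x \<in> X"
    using x unfolding regular_of_order_def by simp
  then have "(f ^^ m) x \<in> A j"
    using j(2) funpow_eq_phi_comp_itinerary[OF x] by auto
  then have "symbol x m = j"
    using symbol_eqI j(1) by blast
  with j show ?thesis
    by simp
qed

lemma regular_of_order_Suc:
  assumes "n0 \<le> m" and x: "regular_of_order X f N A m x"
  shows "regular_of_order X f N A (Suc m) x"
proof -
  have "x \<in> X"
    using x unfolding regular_of_order_def by simp
  then have "(f ^^ m) x \<in> A (symbol x m)" "symbol x m < N"
    using image_itinerary_subset_piece[OF assms] funpow_eq_phi_comp_itinerary[OF x] by auto
  then have "(f ^^ m) x \<notin> singular_set X N A"
    unfolding singular_set_def by blast
  with x show ?thesis
    unfolding regular_of_order_def by (auto simp: less_Suc_eq)
qed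

lemma regular_point_if_regular_of_order:
  assumes "n0 \<le> n" "regular_of_order X f N A n x"
  shows "regular_point X f N A x"
proof -
  have "regular_of_order X f N A (n + d) x" for d
    by (induction d) (use assms regular_of_order_Suc in auto)
  then show ?thesis
    unfolding regular_point_def using regular_of_order_mono[OF _ le_add2] by blast
qed

lemma symbol_eq_if_itinerary_eq:
  assumes "n0 \<le> n" and x: "regular_of_order X f N A n x" and y: "regular_of_order X f N A n y"
    and same: "itinerary x n = itinerary y n"
  shows "symbol x k = symbol y k"
proof (induction k rule: less_induct)
  case (less k)
  show ?case
  proof (cases "k < n")
    case True
    then show ?thesis
      using same nth_itinerary by metis
  next
    case False
    have "regular_of_order X f N A k x" "regular_of_order X f N A k y"
      using regular_point_if_regular_of_order assms unfolding regular_point_def by blast+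
    moreover have "itinerary x k = itinerary y k"
      using less.IH by (simp add: itinerary_def)
    moreover have "y \<in> X"
      using y unfolding regular_of_order_def by simp
    ultimately have "(f ^^ k) y \<in> A (symbol x k)" "symbol x k < N"
      using image_itinerary_subset_piece[of k x] funpow_eq_phi_comp_itinerary[of k y] False assms(1)
      by auto
    then show ?thesis
      using symbol_eqI by metis
  qed
qed

lemma funpow_image_cylinder_subset:
  assumes "n0 \<le> n" and x: "regular_of_order X f N A n x"
  shows "(f ^^ m) ` cylinder X A \<phi> (itinerary x n) \<subseteq> cylinder X A \<phi> (itinerary ((f ^^ m) x) n)"
proof
  fix u assume "u \<in> (f ^^ m) ` cylinder X A \<phi> (itinerary x n)"
  then obtain y where y: "y \<in> cylinder X A \<phi> (itinerary x n)" "u = (f ^^ m) y"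
    by blast
  then have y_reg: "regular_of_order X f N A n y" and "itinerary y n = itinerary x n"
    using mem_cylinder_itinerary_iff[OF x] by blast+
  then have "symbol y k = symbol x k" for k
    using symbol_eq_if_itinerary_eq[OF assms(1) y_reg x] by blast
  then have "itinerary u n = itinerary ((f ^^ m) x) n"
    unfolding y(2) itinerary_def by (simp add: symbol_funpow)
  moreover have "regular_of_order X f N A n u" "regular_of_order X f N A n ((f ^^ m) x)"
    using regular_point_if_regular_of_order[OF assms(1)] regular_point_funpow x y_reg y(2)
    unfolding regular_point_def by blast+
  ultimately show "u \<in> cylinder X A \<phi> (itinerary ((f ^^ m) x) n)"
    using mem_cylinder_itinerary_iff by blast
qed

lemma phi_comp_image_subset_cylinder:
  assumes "n0 \<le> m" and x: "regular_point X f N A x"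
  shows "phi_comp \<phi> (itinerary x m) ` X \<subseteq> cylinder X A \<phi> (itinerary ((f ^^ m) x) n)"
proof
  fix u assume "u \<in> phi_comp \<phi> (itinerary x m) ` X"
  then obtain z where z: "z \<in> X" "u = phi_comp \<phi> (itinerary x m) z"
    by blast
  have reg: "regular_of_order X f N A k x" for k
    using x unfolding regular_point_def by blast
  have "phi_comp \<phi> (take j (itinerary ((f ^^ m) x) n)) u \<in> A (itinerary ((f ^^ m) x) n ! j)"
    if "j < n" for j
  proof -
    have "phi_comp \<phi> (take j (itinerary ((f ^^ m) x) n)) u = phi_comp \<phi> (itinerary x (m + j)) z"
      using that z(2) by (simp add: take_itinerary itinerary_add phi_comp_append)
    also have "\<dots> \<in> A (symbol x (m + j))"
      using image_itinerary_subset_piece[OF _ reg, of "m + j"] assms(1) z(1) by auto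
    finally show ?thesis
      using that by (simp add: symbol_funpow add.commute)
  qed
  moreover have "u \<in> X"
    using z phi_comp_in_X set_itinerary[OF reg] by simp
  ultimately show "u \<in> cylinder X A \<phi> (itinerary ((f ^^ m) x) n)"
    unfolding cylinder_def by simp
qed

lemma closure_funpow_image_cylinder_subset:
  assumes "n0 \<le> n" "n0 \<le> m" and x: "regular_of_order X f N A n x"
  shows "closure ((f ^^ m) ` cylinder X A \<phi> (itinerary x n))
    \<subseteq> cylinder X A \<phi> (itinerary ((f ^^ m) x) n)"
proof -
  have x_pt: "regular_point X f N A x"
    using regular_point_if_regular_of_order[OF assms(1) x] .
  have "(f ^^ m) ` cylinder X A \<phi> (itinerary x n) \<subseteq> phi_comp \<phi> (itinerary x m) ` X"
  proof
    fix u assume "u \<in> (f ^^ m) ` cylinder X A \<phi> (itinerary x n)"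
    then obtain y where y: "y \<in> cylinder X A \<phi> (itinerary x n)" "u = (f ^^ m) y"
      by blast
    then have y_reg: "regular_of_order X f N A n y" and "itinerary y n = itinerary x n"
      using mem_cylinder_itinerary_iff[OF x] by blast+
    then have "itinerary y m = itinerary x m"
      using symbol_eq_if_itinerary_eq[OF assms(1) y_reg x] by (simp add: itinerary_def)
    moreover have "regular_of_order X f N A m y"
      using regular_point_if_regular_of_order[OF assms(1) y_reg] unfolding regular_point_def ..
    moreover have "y \<in> X"
      using y(1) unfolding cylinder_def by blast
    ultimately show "u \<in> phi_comp \<phi> (itinerary x m) ` X"
      using funpow_eq_phi_comp_itinerary y(2) by (metis image_eqI)
  qed
  moreover have "closed (phi_comp \<phi> (itinerary x m) ` X)"
    using compact_phi_comp_image set_itinerary x_pt compact_imp_closed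
    unfolding regular_point_def by blast
  ultimately have "closure ((f ^^ m) ` cylinder X A \<phi> (itinerary x n))
      \<subseteq> phi_comp \<phi> (itinerary x m) ` X"
    by (rule closure_minimal)
  also have "\<dots> \<subseteq> cylinder X A \<phi> (itinerary ((f ^^ m) x) n)"
    using phi_comp_image_subset_cylinder[OF assms(2) x_pt] .
  finally show ?thesis .
qed

lemma strongly_invariant_cyl_collection:
  assumes "2 \<le> n" "n0 \<le> n"
  shows "strongly_invariant X f N A (cyl_collection X f N A \<phi> n)"
proof -
  let ?cyl = "\<lambda>x. cylinder X A \<phi> (itinerary x n)"
  let ?R = "{x. regular_of_order X f N A n x}"
  have coll: "cyl_collection X f N A \<phi> n = ?cyl ` ?R"
    using cyl_collection_eq assms(1) by simp
  have reg_funpow: "(f ^^ m) x \<in> ?R" if "x \<in> ?R" for x m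
    using regular_point_funpow regular_point_if_regular_of_order[OF assms(2)] that
    unfolding regular_point_def by blast
  have in_X: "\<forall>C\<in>cyl_collection X f N A \<phi> n. C \<subseteq> X"
    unfolding coll cylinder_def by auto
  have invariant: "\<exists>C'\<in>cyl_collection X f N A \<phi> n. f ` C \<subseteq> C'"
    if C: "C \<in> cyl_collection X f N A \<phi> n" for C
  proof -
    obtain x where x: "x \<in> ?R" "C = ?cyl x"
      using C unfolding coll by blast
    then have "f ` C \<subseteq> ?cyl ((f ^^ 1) x)"
      using funpow_image_cylinder_subset[OF assms(2), of x 1] by simp
    with x(1) show ?thesis
      unfolding coll using reg_funpow by blast
  qed
  have strongly: "\<exists>B'\<in>cyl_collection X f N A \<phi> n. closure ((f ^^ m) ` B) \<subseteq> B'"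
    if B: "B \<in> cyl_collection X f N A \<phi> n" and m: "n0 \<le> m" for B m
  proof -
    obtain x where x: "x \<in> ?R" "B = ?cyl x"
      using B unfolding coll by blast
    then have "closure ((f ^^ m) ` B) \<subseteq> ?cyl ((f ^^ m) x)"
      using closure_funpow_image_cylinder_subset[OF assms(2) m] by simp
    with x(1) show ?thesis
      unfolding coll using reg_funpow by blast
  qed
  have in_piece: "\<exists>i<N. C \<subseteq> A i" if C: "C \<in> cyl_collection X f N A \<phi> n" for C
  proof -
    obtain x where x: "x \<in> ?R" "C = ?cyl x"
      using C unfolding coll by blast
    moreover have "0 < n"
      using assms(1) by simp
    ultimately show ?thesis
      using cylinder_itinerary_subset_piece regular_of_order_symbol by blast
  qed
  show ?thesis
    unfolding strongly_invariant_def
    using finite_cyl_collection pairwise_disjnt_cyl_collection assms(1)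
      in_X invariant in_piece strongly[OF _ Suc_leD]
    by (intro conjI exI[of _ "Suc n0"]) auto
qed

end

theorem lemma3p6:
  fixes X :: "'a::metric_space set" and lam :: real and f :: "'a \<Rightarrow> 'a"
    and N :: nat and A :: "nat \<Rightarrow> 'a set" and \<phi> :: "nat \<Rightarrow> 'a \<Rightarrow> 'a" and x0 :: 'a
  assumes "standing_space X"
    and "0 < lam" and "lam < 1"
    and "piecewise_contraction X lam f N A \<phi>"
    and "x0 \<in> X"
    and "Omega X f N A \<phi> x0 \<inter> singular_set X N A = {}"
  shows "\<exists>n\<ge>1. (\<forall>x. regular_of_order X f N A n x \<longrightarrow> regular_point X f N A x)
              \<and> strongly_invariant X f N A (cyl_collection X f N A \<phi> n)"
proof -
  interpret pw_contraction X lam f N A \<phi>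
    using assms(1-4) by unfold_locales
  obtain n0 where "eventually_in_pieces X lam f N A \<phi> n0"
    using eventually_images_in_pieces[OF assms(5,6)] assms(1-4)
    by (metis eventually_in_pieces.intro eventually_in_pieces_axioms.intro pw_contraction_axioms)
  then interpret eventually_in_pieces X lam f N A \<phi> n0 .
  let ?n = "max 2 n0"
  have "regular_point X f N A x" if "regular_of_order X f N A ?n x" for x
    using regular_point_if_regular_of_order[OF max.cobounded2 that] .
  moreover have "strongly_invariant X f N A (cyl_collection X f N A \<phi> ?n)"
    using strongly_invariant_cyl_collection by simp
  ultimately show ?thesis
    by (intro exI[of _ ?n]) auto
qed

end
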